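(* Let $R$ be a Noetherian commutative ring of prime characteristic $p>0$, let $I$ be a non-zero proper ideal of $R$, and let $\mathfrak{a}_\bullet$ be a filtration of ideals in $R$ such that for some $N\in\mathbb{N}$, $\mathfrak{a}_{Ns}\subseteq I^s$ for all $s\ge 0$. Then $0\le \mathcal{C}_{-}^I(\mathfrak{a}_\bullet)\le N\mu(I)$ and $0\le \mathcal{C}_{+}^I(\mathfrak{a}_\bullet)\le N\mu(I)$, where $\mu(I)$ denotes the number of elements in a minimal generating set of $I$. In particular, if $R$ is $F$-pure, then $\mathcal{C}^I(\mathfrak{a}_\bullet)$ exists and $$0\le \mathcal{C}^I(\mathfrak{a}_\bullet)=\sup_{e\ge 0}\frac{\nu_{\mathfrak{a}_\bullet}^I(p^e)}{p^e}\le N\mu(I).$$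
   Context: A filtration of ideals in $R$ is a sequence $\mathfrak{a}_\bullet=\{\mathfrak{a}_i\}_{i\ge 0}$ of ideals with $\mathfrak{a}_0=R$, $\mathfrak{a}_{i+1}\subseteq\mathfrak{a}_i$, and $\mathfrak{a}_i\mathfrak{a}_j\subseteq \mathfrak{a}_{i+j}$ for all $i,j\ge 0$. For an ideal $I$, $I^{[p^e]}$ is the ideal generated by all $f^{p^e}$, $f\in I$. For $e\ge 0$ put $\nu_{\mathfrak{a}_\bullet}^I(p^e)=\sup\{r\in\mathbb{Z}_{\ge 0}:\mathfrak{a}_r\not\subseteq I^{[p^e]}\}$, $\mathcal{C}_+^I(\mathfrak{a}_\bullet)=\limsup_{e\to\infty}\nu_{\mathfrak{a}_\bullet}^I(p^e)/p^e$ and $\mathcal{C}_-^I(\mathfrak{a}_\bullet)=\liminf_{e\to\infty}\nu_{\mathfrak{a}_\bullet}^I(p^e)/p^e$. If these coincide and are a finite real number, the common value is denoted $\mathcal{C}^I(\mathfrak{a}_\bullet)$ and is said to exist. $R$ is $F$-pure if the Frobenius map $F:R\to R$, $r\mapsto r^p$, is pure, i.e. $1_M\otimes F: M\otimes_R R\to M\otimes_R R$ is injective for every $R$-module $M$. *)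

theory Defs
  imports
    "HOL-Library.Extended_Real"
    "HOL-Computational_Algebra.Primes"
    "HOL-Algebra.Free_Abelian_Groups"
    "HOL-Algebra.Multiplicative_Group"
    "HOL-Algebra.Module"
    "HOL-Algebra.Ideal_Product"
    "HOL-Algebra.Ring_Divisibility"
begin

section \<open>Characteristic, generators, filtrations and Frobenius powers\<close>

(* group.ord is 0 on elements of infinite order, so this is 0 in characteristic zero. *)
definition ring_characteristic :: "('a, 'b) ring_scheme \<Rightarrow> nat" where
  "ring_characteristic R = group.ord (add_monoid R) \<one>\<^bsub>R\<^esub>"

(* Over a non-local ring, irredundant generating sets of an ideal may differ in size;
   "minimal" is minimal cardinality here. *)
definition min_num_generators :: "('a, 'b) ring_scheme \<Rightarrow> 'a set \<Rightarrow> nat" where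
  "min_num_generators R I =
     (LEAST n. \<exists>A. A \<subseteq> carrier R \<and> finite A \<and> card A = n \<and> genideal R A = I)"

definition ideal_filtration :: "('a, 'b) ring_scheme \<Rightarrow> (nat \<Rightarrow> 'a set) \<Rightarrow> bool" where
  "ideal_filtration R \<aa> \<longleftrightarrow>
     (\<forall>i. ideal (\<aa> i) R) \<and> \<aa> 0 = carrier R \<and> (\<forall>i. \<aa> (Suc i) \<subseteq> \<aa> i) \<and>
     (\<forall>i j. \<aa> i \<cdot>\<^bsub>R\<^esub> \<aa> j \<subseteq> \<aa> (i + j))"

definition frobenius_power :: "('a, 'b) ring_scheme \<Rightarrow> nat \<Rightarrow> 'a set \<Rightarrow> 'a set" where
  "frobenius_power R q I = genideal R {f [^]\<^bsub>R\<^esub> q | f. f \<in> I}"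


section \<open>F-thresholds of filtrations\<close>

(* The supremum is taken in enat, as it may be infinite. *)
definition nu :: "('a, 'b) ring_scheme \<Rightarrow> 'a set \<Rightarrow> (nat \<Rightarrow> 'a set) \<Rightarrow> nat \<Rightarrow> enat" where
  "nu R I \<aa> q = (SUP r \<in> {r. \<not> \<aa> r \<subseteq> frobenius_power R q I}. enat r)"

definition nu_ratio ::
  "('a, 'b) ring_scheme \<Rightarrow> nat \<Rightarrow> 'a set \<Rightarrow> (nat \<Rightarrow> 'a set) \<Rightarrow> nat \<Rightarrow> ereal" where
  "nu_ratio R p I \<aa> e = ereal_of_enat (nu R I \<aa> (p ^ e)) / ereal (real (p ^ e))"

definition upper_F_threshold ::
  "('a, 'b) ring_scheme \<Rightarrow> nat \<Rightarrow> 'a set \<Rightarrow> (nat \<Rightarrow> 'a set) \<Rightarrow> ereal" where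
  "upper_F_threshold R p I \<aa> = limsup (nu_ratio R p I \<aa>)"

definition lower_F_threshold ::
  "('a, 'b) ring_scheme \<Rightarrow> nat \<Rightarrow> 'a set \<Rightarrow> (nat \<Rightarrow> 'a set) \<Rightarrow> ereal" where
  "lower_F_threshold R p I \<aa> = liminf (nu_ratio R p I \<aa>)"

definition F_threshold_exists ::
  "('a, 'b) ring_scheme \<Rightarrow> nat \<Rightarrow> 'a set \<Rightarrow> (nat \<Rightarrow> 'a set) \<Rightarrow> bool" where
  "F_threshold_exists R p I \<aa> \<longleftrightarrow>
     (\<exists>c::real. lower_F_threshold R p I \<aa> = ereal c \<and> upper_F_threshold R p I \<aa> = ereal c)"

(* Meaningful only if F_threshold_exists holds. *)
definition F_threshold ::
  "('a, 'b) ring_scheme \<Rightarrow> nat \<Rightarrow> 'a set \<Rightarrow> (nat \<Rightarrow> 'a set) \<Rightarrow> real" where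
  "F_threshold R p I \<aa> = real_of_ereal (upper_F_threshold R p I \<aa>)"


section \<open>Tensor products and purity\<close>

definition tensor_relations ::
  "('a, 'b) ring_scheme \<Rightarrow> ('a, 'm) module \<Rightarrow> ('a, 'n) module \<Rightarrow> ('m \<times> 'n \<Rightarrow>\<^sub>0 int) set" where
  "tensor_relations R M N =
     {frag_of (x \<oplus>\<^bsub>M\<^esub> y, n) - frag_of (x, n) - frag_of (y, n) | x y n.
        x \<in> carrier M \<and> y \<in> carrier M \<and> n \<in> carrier N} \<union>
     {frag_of (x, n \<oplus>\<^bsub>N\<^esub> k) - frag_of (x, n) - frag_of (x, k) | x n k.
        x \<in> carrier M \<and> n \<in> carrier N \<and> k \<in> carrier N} \<union>
     {frag_of (r \<odot>\<^bsub>M\<^esub> x, n) - frag_of (x, r \<odot>\<^bsub>N\<^esub> n) | r x n.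
        r \<in> carrier R \<and> x \<in> carrier M \<and> n \<in> carrier N}"

abbreviation free_on_pairs :: "('a, 'm) module \<Rightarrow> ('a, 'n) module \<Rightarrow> ('m \<times> 'n \<Rightarrow>\<^sub>0 int) monoid" where
  "free_on_pairs M N \<equiv> free_Abelian_group (carrier M \<times> carrier N)"

definition tensor_kernel ::
  "('a, 'b) ring_scheme \<Rightarrow> ('a, 'm) module \<Rightarrow> ('a, 'n) module \<Rightarrow> ('m \<times> 'n \<Rightarrow>\<^sub>0 int) set" where
  "tensor_kernel R M N = generate (free_on_pairs M N) (tensor_relations R M N)"

(* The underlying abelian group of the tensor product over R. Its R-module structure is
   irrelevant for injectivity and is not recorded. *)
definition tensor_product ::
  "('a, 'b) ring_scheme \<Rightarrow> ('a, 'm) module \<Rightarrow> ('a, 'n) module \<Rightarrow> ('m \<times> 'n \<Rightarrow>\<^sub>0 int) set monoid" where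
  "tensor_product R M N = free_on_pairs M N Mod tensor_kernel R M N"

abbreviation frag_map :: "('m \<Rightarrow> 'k) \<Rightarrow> ('n \<Rightarrow> 'l) \<Rightarrow> ('m \<times> 'n \<Rightarrow>\<^sub>0 int) \<Rightarrow> ('k \<times> 'l \<Rightarrow>\<^sub>0 int)" where
  "frag_map g f \<equiv> frag_extend (\<lambda>(m, n). frag_of (g m, f n))"

(* The map induced by id and f from the tensor product of M and N to that of M and N':
   a coset X is sent to the coset of the tensor kernel which contains the image of X. *)
definition tensor_map ::
  "('a, 'b) ring_scheme \<Rightarrow> ('a, 'm) module \<Rightarrow> ('a, 'l) module \<Rightarrow> ('n \<Rightarrow> 'l) \<Rightarrow>
     ('m \<times> 'n \<Rightarrow>\<^sub>0 int) set \<Rightarrow> ('m \<times> 'l \<Rightarrow>\<^sub>0 int) set" where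
  "tensor_map R M N' f X = tensor_kernel R M N' <#>\<^bsub>free_on_pairs M N'\<^esub> (frag_map id f ` X)"

(* HOL cannot quantify over the type of the elements of the test module M inside a formula.
   The type used here is large enough to accommodate every finitely generated R-module (an
   element of a module with generators g 0, ..., g (n - 1) is represented by the set of its
   coefficient sequences), and this is sufficient: see pure_map_all_modules below. *)
definition pure_map ::
  "('a, 'b) ring_scheme \<Rightarrow> ('a, 'n) module \<Rightarrow> ('a, 'l) module \<Rightarrow> ('n \<Rightarrow> 'l) \<Rightarrow> bool" where
  "pure_map R N N' f \<longleftrightarrow>
     (\<forall>M :: ('a, (nat \<Rightarrow> 'a) set) module. module R M \<longrightarrow>
        inj_on (tensor_map R M N' f) (carrier (tensor_product R M N)))"

definition regular_module :: "('a, 'b) ring_scheme \<Rightarrow> ('a, 'a) module" where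
  "regular_module R = \<lparr>carrier = carrier R, monoid.mult = monoid.mult R, one = \<one>\<^bsub>R\<^esub>, zero = \<zero>\<^bsub>R\<^esub>, add = add R,
     smult = monoid.mult R\<rparr>"

(* R as a module over itself by restriction of scalars along the Frobenius map. *)
definition frobenius_module :: "('a, 'b) ring_scheme \<Rightarrow> nat \<Rightarrow> ('a, 'a) module" where
  "frobenius_module R p = \<lparr>carrier = carrier R, monoid.mult = monoid.mult R, one = \<one>\<^bsub>R\<^esub>, zero = \<zero>\<^bsub>R\<^esub>, add = add R,
     smult = (\<lambda>r x. (r [^]\<^bsub>R\<^esub> p) \<otimes>\<^bsub>R\<^esub> x)\<rparr>"

definition F_pure :: "('a, 'b) ring_scheme \<Rightarrow> nat \<Rightarrow> bool" where
  "F_pure R p \<longleftrightarrow> pure_map R (regular_module R) (frobenius_module R p) (\<lambda>r. r [^]\<^bsub>R\<^esub> p)"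


section \<open>Purity against modules over arbitrary types\<close>

definition module_linear ::
  "('a, 'b) ring_scheme \<Rightarrow> ('a, 'm) module \<Rightarrow> ('a, 'n) module \<Rightarrow> ('m \<Rightarrow> 'n) \<Rightarrow> bool" where
  "module_linear R M N f \<longleftrightarrow>
     (\<forall>x \<in> carrier M. f x \<in> carrier N) \<and>
     (\<forall>x \<in> carrier M. \<forall>y \<in> carrier M. f (x \<oplus>\<^bsub>M\<^esub> y) = f x \<oplus>\<^bsub>N\<^esub> f y) \<and>
     (\<forall>r \<in> carrier R. \<forall>x \<in> carrier M. f (r \<odot>\<^bsub>M\<^esub> x) = r \<odot>\<^bsub>N\<^esub> f x)"

lemma tensor_relationsI:
  "x \<in> carrier M \<Longrightarrow> y \<in> carrier M \<Longrightarrow> n \<in> carrier N \<Longrightarrow>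
     frag_of (x \<oplus>\<^bsub>M\<^esub> y, n) - frag_of (x, n) - frag_of (y, n) \<in> tensor_relations R M N"
  "x \<in> carrier M \<Longrightarrow> n \<in> carrier N \<Longrightarrow> k \<in> carrier N \<Longrightarrow>
     frag_of (x, n \<oplus>\<^bsub>N\<^esub> k) - frag_of (x, n) - frag_of (x, k) \<in> tensor_relations R M N"
  "r \<in> carrier R \<Longrightarrow> x \<in> carrier M \<Longrightarrow> n \<in> carrier N \<Longrightarrow>
     frag_of (r \<odot>\<^bsub>M\<^esub> x, n) - frag_of (x, r \<odot>\<^bsub>N\<^esub> n) \<in> tensor_relations R M N"
  unfolding tensor_relations_def by blast+

lemma module_linear_id: "module_linear R M M id"
  by (simp add: module_linear_def)

lemma tensor_relations_sub:
  assumes "module R M" and "module R N"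
  shows "tensor_relations R M N \<subseteq> carrier (free_on_pairs M N)"
proof -
  interpret M: module R M by fact
  interpret N: module R N by fact
  have d: "a - b \<in> carrier (free_on_pairs M N)"
    if "a \<in> carrier (free_on_pairs M N)" "b \<in> carrier (free_on_pairs M N)" for a b
    using that keys_diff[of a b] by auto
  show ?thesis
    unfolding tensor_relations_def by (auto intro!: d simp del: carrier_free_Abelian_group_iff)
qed

lemma tensor_kernel_subgroup:
  assumes "module R M" and "module R N"
  shows "subgroup (tensor_kernel R M N) (free_on_pairs M N)"
  unfolding tensor_kernel_def
  using group.generate_is_subgroup[OF group_free_Abelian_group tensor_relations_sub[OF assms]] .

lemma tensor_kernel_induct [consumes 3, case_names zero rel minus add]:
  assumes z: "z \<in> tensor_kernel R M N" and M: "module R M" and N: "module R N"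
    and "P 0" and "\<And>h. h \<in> tensor_relations R M N \<Longrightarrow> P h"
    and "\<And>h. h \<in> tensor_relations R M N \<Longrightarrow> P (- h)"
    and "\<And>h k. P h \<Longrightarrow> P k \<Longrightarrow> P (h + k)"
  shows "P z"
  using z unfolding tensor_kernel_def
proof induction
  case (inv h)
  then have "Poly_Mapping.keys h \<subseteq> carrier M \<times> carrier N"
    using subsetD[OF tensor_relations_sub[OF M N]] by simp
  then show ?case using inv assms(6) by simp
qed (use assms in auto)

lemma tensor_kernel_zero: "0 \<in> tensor_kernel R M N"
  unfolding tensor_kernel_def by (metis generate.one one_free_Abelian_group)

lemma tensor_kernel_rel: "h \<in> tensor_relations R M N \<Longrightarrow> h \<in> tensor_kernel R M N"
  unfolding tensor_kernel_def by (rule generate.incl)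

lemma tensor_kernel_add:
  "h \<in> tensor_kernel R M N \<Longrightarrow> k \<in> tensor_kernel R M N \<Longrightarrow> h + k \<in> tensor_kernel R M N"
  unfolding tensor_kernel_def using generate.eng by fastforce

lemma tensor_kernel_minus:
  assumes "module R M" and "module R N" and "h \<in> tensor_kernel R M N"
  shows "- h \<in> tensor_kernel R M N"
proof -
  have "h \<in> carrier (free_on_pairs M N)"
    using subgroup.subset[OF tensor_kernel_subgroup] assms by blast
  then show ?thesis
    using subgroup.m_inv_closed[OF tensor_kernel_subgroup] assms by fastforce
qed

lemma frag_map_diff: "frag_map g f (a - b) = frag_map g f a - frag_map g f b"
  by (rule frag_extend_diff)

lemma frag_map_comp: "frag_map g f (frag_map g' f' z) = frag_map (g \<circ> g') (f \<circ> f') z"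
proof -
  have e: "(\<lambda>(m, n). frag_of (g m, f n)) = frag_of \<circ> map_prod g f" for g f
    by auto
  show ?thesis
    unfolding e frag_extend_compose by (simp add: comp_assoc map_prod.comp) (simp add: comp_def)
qed

lemma frag_map_ident:
  assumes "\<And>m n. (m, n) \<in> Poly_Mapping.keys z \<Longrightarrow> g m = m"
  shows "frag_map g id z = z"
proof -
  have "frag_map g id z = frag_extend frag_of z"
    using assms by (intro frag_extend_eq) auto
  then show ?thesis by (simp flip: frag_expansion)
qed

lemma frag_map_relation:
  assumes "module_linear R M M' g" and "module_linear R N N' f" and "h \<in> tensor_relations R M N"
  shows "frag_map g f h \<in> tensor_relations R M' N'"
proof -
  note lin = assms(1,2)[unfolded module_linear_def]
  from assms(3) consider
      (1) x y n where "h = frag_of (x \<oplus>\<^bsub>M\<^esub> y, n) - frag_of (x, n) - frag_of (y, n)"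
        "x \<in> carrier M" "y \<in> carrier M" "n \<in> carrier N"
    | (2) x n k where "h = frag_of (x, n \<oplus>\<^bsub>N\<^esub> k) - frag_of (x, n) - frag_of (x, k)"
        "x \<in> carrier M" "n \<in> carrier N" "k \<in> carrier N"
    | (3) r x n where "h = frag_of (r \<odot>\<^bsub>M\<^esub> x, n) - frag_of (x, r \<odot>\<^bsub>N\<^esub> n)"
        "r \<in> carrier R" "x \<in> carrier M" "n \<in> carrier N"
    unfolding tensor_relations_def by blast
  then show ?thesis
  proof cases
    case 1
    then have "frag_map g f h = frag_of (g x \<oplus>\<^bsub>M'\<^esub> g y, f n) - frag_of (g x, f n) - frag_of (g y, f n)"
      using lin by (simp add: frag_map_diff)
    then show ?thesis using 1 lin by (simp add: tensor_relationsI)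
  next
    case 2
    then have "frag_map g f h = frag_of (g x, f n \<oplus>\<^bsub>N'\<^esub> f k) - frag_of (g x, f n) - frag_of (g x, f k)"
      using lin by (simp add: frag_map_diff)
    then show ?thesis using 2 lin by (simp add: tensor_relationsI)
  next
    case 3
    then have "frag_map g f h = frag_of (r \<odot>\<^bsub>M'\<^esub> g x, f n) - frag_of (g x, r \<odot>\<^bsub>N'\<^esub> f n)"
      using lin by (simp add: frag_map_diff)
    then show ?thesis using 3 lin by (simp add: tensor_relationsI)
  qed
qed

lemma frag_map_kernel:
  assumes "module R M" "module R N" "module R M'" "module R N'"
    and "module_linear R M M' g" and "module_linear R N N' f"
    and "h \<in> tensor_kernel R M N"
  shows "frag_map g f h \<in> tensor_kernel R M' N'"
  using assms(7,1,2)
proof (induction rule: tensor_kernel_induct)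
  case zero
  then show ?case by (simp add: tensor_kernel_zero)
next
  case (rel h)
  show ?case
    by (rule tensor_kernel_rel, rule frag_map_relation[OF assms(5,6) rel])
next
  case (minus h)
  have "frag_map g f h \<in> tensor_kernel R M' N'"
    by (rule tensor_kernel_rel, rule frag_map_relation[OF assms(5,6) minus])
  then show ?case
    using tensor_kernel_minus[OF assms(3,4)] by (simp add: frag_extend_minus)
next
  case (add h k)
  then show ?case by (simp add: frag_extend_add tensor_kernel_add)
qed

lemma frag_map_carrier:
  assumes "module_linear R M M' g" and "module_linear R N N' f"
    and "h \<in> carrier (free_on_pairs M N)"
  shows "frag_map g f h \<in> carrier (free_on_pairs M' N')"
proof -
  have "Poly_Mapping.keys (frag_map g f h) \<subseteq>
      (\<Union>x \<in> Poly_Mapping.keys h. Poly_Mapping.keys ((\<lambda>(m, n). frag_of (g m, f n)) x))"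
    by (rule keys_frag_extend)
  also have "\<dots> \<subseteq> carrier M' \<times> carrier N'"
    using assms by (auto simp: keys_frag_of module_linear_def)
  finally show ?thesis by simp
qed

lemma inj_on_tensor_map_iff:
  assumes M: "module R M" and N: "module R N" and N': "module R N'" and f: "module_linear R N N' f"
  shows "inj_on (tensor_map R M N' f) (carrier (tensor_product R M N)) \<longleftrightarrow>
    (\<forall>z \<in> carrier (free_on_pairs M N). frag_map id f z \<in> tensor_kernel R M N' \<longrightarrow> z \<in> tensor_kernel R M N)"
    (is "?inj \<longleftrightarrow> ?ker")
proof -
  let ?F = "free_on_pairs M N" and ?K = "tensor_kernel R M N"
  let ?F' = "free_on_pairs M N'" and ?K' = "tensor_kernel R M N'"
  let ?h = "frag_map id f :: ('c \<times> 'd \<Rightarrow>\<^sub>0 int) \<Rightarrow> _"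
  have sub: "subgroup ?K ?F" and sub': "subgroup ?K' ?F'"
    using M N N' tensor_kernel_subgroup by blast+
  have coset: "?K #>\<^bsub>?F\<^esub> x = (\<lambda>k. k + x) ` ?K" for x
    by (auto simp: r_coset_def)
  have map: "tensor_map R M N' f (?K #>\<^bsub>?F\<^esub> x) = (\<lambda>k. k + ?h x) ` ?K'" for x
  proof
    show "tensor_map R M N' f (?K #>\<^bsub>?F\<^esub> x) \<subseteq> (\<lambda>k. k + ?h x) ` ?K'"
    proof
      fix y assume "y \<in> tensor_map R M N' f (?K #>\<^bsub>?F\<^esub> x)"
      then obtain k' k where k: "k' \<in> ?K'" "k \<in> ?K" "y = k' + ?h (k + x)"
        unfolding tensor_map_def coset set_mult_def by auto
      moreover have "?h k \<in> ?K'"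
        using frag_map_kernel[OF M N M N' module_linear_id f k(2)] .
      ultimately show "y \<in> (\<lambda>k. k + ?h x) ` ?K'"
        using tensor_kernel_add[of k' R M N' "?h k"]
        by (auto simp: frag_extend_add add.assoc[symmetric])
    qed
    show "(\<lambda>k. k + ?h x) ` ?K' \<subseteq> tensor_map R M N' f (?K #>\<^bsub>?F\<^esub> x)"
      unfolding tensor_map_def coset set_mult_def
      using tensor_kernel_zero[of R M N] by force
  qed
  have trans: "(\<lambda>k. k + x) ` K = (\<lambda>k. k + y) ` K \<longleftrightarrow> x - y \<in> K"
    if "0 \<in> K" "\<And>h k. h \<in> K \<Longrightarrow> k \<in> K \<Longrightarrow> h + k \<in> K" "\<And>h. h \<in> K \<Longrightarrow> - h \<in> K"
    for x y and K :: "('w \<Rightarrow>\<^sub>0 int) set"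
  proof
    assume eq: "(\<lambda>k. k + x) ` K = (\<lambda>k. k + y) ` K"
    have "x \<in> (\<lambda>k. k + x) ` K" using that(1) by force
    then have "x \<in> (\<lambda>k. k + y) ` K" using eq by simp
    then show "x - y \<in> K" by auto
  next
    assume d: "x - y \<in> K"
    have 1: "k + x \<in> (\<lambda>k. k + y) ` K" if "k \<in> K" for k
      using that(1) that(1)[THEN \<open>\<And>h k. h \<in> K \<Longrightarrow> k \<in> K \<Longrightarrow> h + k \<in> K\<close>, OF d]
      by (intro image_eqI[of _ _ "k + (x - y)"]) auto
    have 2: "k + y \<in> (\<lambda>k. k + x) ` K" if "k \<in> K" for k
      using that(1)[THEN \<open>\<And>h k. h \<in> K \<Longrightarrow> k \<in> K \<Longrightarrow> h + k \<in> K\<close>, OF \<open>\<And>h. h \<in> K \<Longrightarrow> - h \<in> K\<close>[OF d]]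
      by (intro image_eqI[of _ _ "k + - (x - y)"]) auto
    show "(\<lambda>k. k + x) ` K = (\<lambda>k. k + y) ` K" using 1 2 by blast
  qed
  have tK: "(\<lambda>k. k + x) ` ?K = (\<lambda>k. k + y) ` ?K \<longleftrightarrow> x - y \<in> ?K" for x y
    using tensor_kernel_zero tensor_kernel_add tensor_kernel_minus[OF M N] by (intro trans)
  have tK': "(\<lambda>k. k + x) ` ?K' = (\<lambda>k. k + y) ` ?K' \<longleftrightarrow> x - y \<in> ?K'" for x y
    using tensor_kernel_zero tensor_kernel_add tensor_kernel_minus[OF M N'] by (intro trans)
  have car: "carrier (tensor_product R M N) = (\<lambda>x. ?K #>\<^bsub>?F\<^esub> x) ` carrier ?F"
    by (auto simp: tensor_product_def FactGroup_def RCOSETS_def)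
  have "?inj \<longleftrightarrow> (\<forall>x \<in> carrier ?F. \<forall>y \<in> carrier ?F. ?h x - ?h y \<in> ?K' \<longrightarrow> x - y \<in> ?K)"
    unfolding inj_on_def car ball_simps map unfolding coset tK tK' ..
  also have "\<dots> \<longleftrightarrow> ?ker"
  proof (intro iffI ballI impI)
    fix z assume *: "\<forall>x \<in> carrier ?F. \<forall>y \<in> carrier ?F. ?h x - ?h y \<in> ?K' \<longrightarrow> x - y \<in> ?K"
      and "z \<in> carrier ?F" "?h z \<in> ?K'"
    then show "z \<in> ?K" using bspec[OF bspec[OF *, of z], of 0] by simp
  next
    fix x y assume *: ?ker and "x \<in> carrier ?F" "y \<in> carrier ?F" "?h x - ?h y \<in> ?K'"
    moreover from this have "x - y \<in> carrier ?F" using keys_diff[of x y] by auto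
    ultimately show "x - y \<in> ?K" by (simp add: frag_map_diff)
  qed
  finally show ?thesis .
qed

primrec lin_comb :: "('a, 'm, 'x) module_scheme \<Rightarrow> (nat \<Rightarrow> 'm) \<Rightarrow> nat \<Rightarrow> (nat \<Rightarrow> 'a) \<Rightarrow> 'm" where
  "lin_comb M g 0 c = \<zero>\<^bsub>M\<^esub>"
| "lin_comb M g (Suc n) c = lin_comb M g n c \<oplus>\<^bsub>M\<^esub> (c n \<odot>\<^bsub>M\<^esub> g n)"

definition span_module ::
  "('a, 'b) ring_scheme \<Rightarrow> ('a, 'm, 'x) module_scheme \<Rightarrow> (nat \<Rightarrow> 'm) \<Rightarrow> nat \<Rightarrow>
     ('a, 'm, 'x) module_scheme" where
  "span_module R M g n = M\<lparr>carrier := lin_comb M g n ` (UNIV \<rightarrow> carrier R)\<rparr>"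

lemma span_module_simps [simp]:
  "add (span_module R M g n) = add M" "\<zero>\<^bsub>span_module R M g n\<^esub> = \<zero>\<^bsub>M\<^esub>"
  "smult (span_module R M g n) = smult M"
  "carrier (span_module R M g n) = lin_comb M g n ` (UNIV \<rightarrow> carrier R)"
  by (simp_all add: span_module_def)

context module
begin

context
  fixes g :: "nat \<Rightarrow> 'c" and n :: nat
  assumes g: "\<And>i. i < n \<Longrightarrow> g i \<in> carrier M"
begin

lemma lin_comb_closed:
  "k \<le> n \<Longrightarrow> c \<in> UNIV \<rightarrow> carrier R \<Longrightarrow> lin_comb M g k c \<in> carrier M"
  using g by (induction k) (auto simp: Pi_iff)

lemma lin_comb_add:
  "k \<le> n \<Longrightarrow> c \<in> UNIV \<rightarrow> carrier R \<Longrightarrow> d \<in> UNIV \<rightarrow> carrier R \<Longrightarrow>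
   lin_comb M g k (\<lambda>i. c i \<oplus>\<^bsub>R\<^esub> d i) = lin_comb M g k c \<oplus>\<^bsub>M\<^esub> lin_comb M g k d"
proof (induction k)
  case (Suc k)
  have "c k \<in> carrier R" "d k \<in> carrier R" "g k \<in> carrier M"
    "lin_comb M g k c \<in> carrier M" "lin_comb M g k d \<in> carrier M"
    using Suc g lin_comb_closed by auto
  then show ?case using Suc by (simp add: smult_l_distr M.a_ac)
qed simp

lemma lin_comb_smult:
  "k \<le> n \<Longrightarrow> c \<in> UNIV \<rightarrow> carrier R \<Longrightarrow> r \<in> carrier R \<Longrightarrow>
   lin_comb M g k (\<lambda>i. r \<otimes>\<^bsub>R\<^esub> c i) = r \<odot>\<^bsub>M\<^esub> lin_comb M g k c"
proof (induction k)
  case (Suc k)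
  have "c k \<in> carrier R" "g k \<in> carrier M" "lin_comb M g k c \<in> carrier M"
    using Suc g lin_comb_closed by auto
  then show ?case using Suc by (simp add: smult_r_distr smult_assoc1)
qed simp

lemma lin_comb_zero: "k \<le> n \<Longrightarrow> lin_comb M g k (\<lambda>_. \<zero>\<^bsub>R\<^esub>) = \<zero>\<^bsub>M\<^esub>"
  using g by (induction k) auto

lemma lin_comb_unit:
  "k \<le> n \<Longrightarrow> lin_comb M g k (\<lambda>i. if i = j then \<one>\<^bsub>R\<^esub> else \<zero>\<^bsub>R\<^esub>) = (if j < k then g j else \<zero>\<^bsub>M\<^esub>)"
  using g by (induction k) (auto simp: less_Suc_eq)

lemma span_module_subset: "carrier (span_module R M g n) \<subseteq> carrier M"
  using lin_comb_closed[of n] by auto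

lemma generator_in_span:
  assumes "j < n"
  shows "g j \<in> carrier (span_module R M g n)"
proof -
  have "g j = lin_comb M g n (\<lambda>i. if i = j then \<one>\<^bsub>R\<^esub> else \<zero>\<^bsub>R\<^esub>)"
    using lin_comb_unit[of n j] assms by simp
  moreover have "(\<lambda>i. if i = j then \<one>\<^bsub>R\<^esub> else \<zero>\<^bsub>R\<^esub>) \<in> UNIV \<rightarrow> carrier R"
    by simp
  ultimately show ?thesis unfolding span_module_simps by (rule image_eqI)
qed

lemma span_module_zero: "\<zero>\<^bsub>M\<^esub> \<in> carrier (span_module R M g n)"
  unfolding span_module_simps
  by (rule image_eqI[where x = "\<lambda>_. \<zero>\<^bsub>R\<^esub>"]) (simp_all add: lin_comb_zero)

lemma span_module_add:
  assumes "x \<in> carrier (span_module R M g n)" and "y \<in> carrier (span_module R M g n)"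
  shows "x \<oplus>\<^bsub>M\<^esub> y \<in> carrier (span_module R M g n)"
proof -
  obtain c d where c: "c \<in> UNIV \<rightarrow> carrier R" "x = lin_comb M g n c"
    and d: "d \<in> UNIV \<rightarrow> carrier R" "y = lin_comb M g n d"
    using assms by auto
  have "x \<oplus>\<^bsub>M\<^esub> y = lin_comb M g n (\<lambda>i. c i \<oplus>\<^bsub>R\<^esub> d i)"
    using lin_comb_add[of n c d] c d by simp
  moreover have "(\<lambda>i. c i \<oplus>\<^bsub>R\<^esub> d i) \<in> UNIV \<rightarrow> carrier R"
    using c d by (simp add: Pi_iff)
  ultimately show ?thesis unfolding span_module_simps by (rule image_eqI)
qed

lemma span_module_smult:
  assumes "r \<in> carrier R" and "x \<in> carrier (span_module R M g n)"
  shows "r \<odot>\<^bsub>M\<^esub> x \<in> carrier (span_module R M g n)"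
proof -
  obtain c where c: "c \<in> UNIV \<rightarrow> carrier R" "x = lin_comb M g n c"
    using assms by auto
  have "r \<odot>\<^bsub>M\<^esub> x = lin_comb M g n (\<lambda>i. r \<otimes>\<^bsub>R\<^esub> c i)"
    using lin_comb_smult[of n c r] c assms by simp
  moreover have "(\<lambda>i. r \<otimes>\<^bsub>R\<^esub> c i) \<in> UNIV \<rightarrow> carrier R"
    using c assms by (simp add: Pi_iff)
  ultimately show ?thesis unfolding span_module_simps by (rule image_eqI)
qed

lemmas span_module_closed = span_module_zero span_module_add span_module_smult

end

lemma smult_minus_one_left:
  assumes "x \<in> carrier M"
  shows "(\<ominus>\<^bsub>R\<^esub> \<one>\<^bsub>R\<^esub>) \<odot>\<^bsub>M\<^esub> x \<oplus>\<^bsub>M\<^esub> x = \<zero>\<^bsub>M\<^esub>"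
  using assms smult_l_minus[of "\<one>\<^bsub>R\<^esub>" x] by (simp add: M.l_neg)

lemma transported_module:
  assumes H: "H \<subseteq> carrier M" "\<zero>\<^bsub>M\<^esub> \<in> H" "\<And>x y. x \<in> H \<Longrightarrow> y \<in> H \<Longrightarrow> x \<oplus>\<^bsub>M\<^esub> y \<in> H"
    "\<And>r x. r \<in> carrier R \<Longrightarrow> x \<in> H \<Longrightarrow> r \<odot>\<^bsub>M\<^esub> x \<in> H"
    and inv: "\<And>x. x \<in> H \<Longrightarrow> \<psi> (\<phi> x) = x"
  shows "module R \<lparr>carrier = \<phi> ` H, monoid.mult = undefined, one = undefined, zero = \<phi> \<zero>\<^bsub>M\<^esub>,
    add = (\<lambda>u v. \<phi> (\<psi> u \<oplus>\<^bsub>M\<^esub> \<psi> v)), smult = (\<lambda>r u. \<phi> (r \<odot>\<^bsub>M\<^esub> \<psi> u))\<rparr>" (is "module R ?T")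
proof (rule moduleI)
  show "cring R" by (rule R.is_cring)
  show "abelian_group ?T"
  proof (rule abelian_groupI)
    fix x assume "x \<in> carrier ?T"
    then obtain h where h: "h \<in> H" "x = \<phi> h" by auto
    have "(\<ominus>\<^bsub>R\<^esub> \<one>\<^bsub>R\<^esub>) \<odot>\<^bsub>M\<^esub> h \<in> H" using H(4) h by simp
    then show "\<exists>y \<in> carrier ?T. y \<oplus>\<^bsub>?T\<^esub> x = \<zero>\<^bsub>?T\<^esub>"
      using h smult_minus_one_left[OF subsetD[OF H(1) h(1)]]
      by (intro bexI[of _ "\<phi> ((\<ominus>\<^bsub>R\<^esub> \<one>\<^bsub>R\<^esub>) \<odot>\<^bsub>M\<^esub> h)"]) (simp_all add: inv)
  next
    fix x y z assume "x \<in> carrier ?T" "y \<in> carrier ?T" "z \<in> carrier ?T"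
    then obtain h k l where "h \<in> H" "k \<in> H" "l \<in> H" "x = \<phi> h" "y = \<phi> k" "z = \<phi> l" by auto
    then show "x \<oplus>\<^bsub>?T\<^esub> y \<oplus>\<^bsub>?T\<^esub> z = x \<oplus>\<^bsub>?T\<^esub> (y \<oplus>\<^bsub>?T\<^esub> z)"
      using subsetD[OF H(1)] by (simp add: inv H(2-4) M.a_assoc)
  next
    fix x y assume "x \<in> carrier ?T" "y \<in> carrier ?T"
    then obtain h k where hk: "h \<in> H" "k \<in> H" "x = \<phi> h" "y = \<phi> k" by auto
    then show "x \<oplus>\<^bsub>?T\<^esub> y = y \<oplus>\<^bsub>?T\<^esub> x"
      using subsetD[OF H(1)] by (simp add: inv M.a_comm)
    show "x \<oplus>\<^bsub>?T\<^esub> y \<in> carrier ?T" using hk by (simp add: inv H(2-4))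
  next
    fix x assume "x \<in> carrier ?T"
    then obtain h where "h \<in> H" "x = \<phi> h" by auto
    then show "\<zero>\<^bsub>?T\<^esub> \<oplus>\<^bsub>?T\<^esub> x = x" using subsetD[OF H(1)] by (simp add: inv H(2-4))
  qed (simp add: H)
next
  fix a x assume "a \<in> carrier R" "x \<in> carrier ?T"
  then show "a \<odot>\<^bsub>?T\<^esub> x \<in> carrier ?T" by (auto simp: inv H(2-4))
next
  fix a b x assume ab: "a \<in> carrier R" "b \<in> carrier R" and "x \<in> carrier ?T"
  then obtain h where "h \<in> H" "x = \<phi> h" by auto
  with ab show "(a \<oplus>\<^bsub>R\<^esub> b) \<odot>\<^bsub>?T\<^esub> x = a \<odot>\<^bsub>?T\<^esub> x \<oplus>\<^bsub>?T\<^esub> b \<odot>\<^bsub>?T\<^esub> x"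
    "a \<otimes>\<^bsub>R\<^esub> b \<odot>\<^bsub>?T\<^esub> x = a \<odot>\<^bsub>?T\<^esub> (b \<odot>\<^bsub>?T\<^esub> x)"
    using subsetD[OF H(1)] by (simp_all add: inv H(2-4) smult_l_distr smult_assoc1)
next
  fix a x y assume a: "a \<in> carrier R" and "x \<in> carrier ?T" "y \<in> carrier ?T"
  then obtain h k where "h \<in> H" "k \<in> H" "x = \<phi> h" "y = \<phi> k" by auto
  with a show "a \<odot>\<^bsub>?T\<^esub> (x \<oplus>\<^bsub>?T\<^esub> y) = a \<odot>\<^bsub>?T\<^esub> x \<oplus>\<^bsub>?T\<^esub> a \<odot>\<^bsub>?T\<^esub> y"
    using subsetD[OF H(1)] by (simp add: inv H(2-4) smult_r_distr)
next
  fix x assume "x \<in> carrier ?T"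
  then obtain h where "h \<in> H" "x = \<phi> h" by auto
  then show "\<one>\<^bsub>R\<^esub> \<odot>\<^bsub>?T\<^esub> x = x" using subsetD[OF H(1)] by (simp add: inv)
qed

end

lemma span_module_module:
  assumes "module R M" and "\<And>i. i < n \<Longrightarrow> g i \<in> carrier M"
  shows "module R (span_module R M g n)"
proof -
  interpret module R M by fact
  note cl = span_module_closed[where g = g and n = n, OF assms(2)]
  have sub: "carrier (span_module R M g n) \<subseteq> carrier M"
    by (rule span_module_subset[where g = g and n = n, OF assms(2)])
  have "submodule (carrier (span_module R M g n)) R M"
  proof (rule submoduleI)
    fix x assume x: "x \<in> carrier (span_module R M g n)"
    then have "\<ominus>\<^bsub>M\<^esub> x = (\<ominus>\<^bsub>R\<^esub> \<one>\<^bsub>R\<^esub>) \<odot>\<^bsub>M\<^esub> x"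
      using subsetD[OF sub x] by (simp add: smult_l_minus)
    then show "\<ominus>\<^bsub>M\<^esub> x \<in> carrier (span_module R M g n)"
      using cl(3)[OF _ _ x] by simp
  qed (rule sub, (rule span_module_zero span_module_add span_module_smult; (assumption | erule assms(2)))+)
  from submodule.submodule_is_module[OF this module_axioms]
  show ?thesis by (simp add: span_module_def)
qed

lemma tensor_relations_finite_support:
  assumes "h \<in> tensor_relations R M N"
  shows "\<exists>S. finite S \<and> S \<subseteq> carrier M \<and> (\<forall>g n. (\<forall>i<n. g i \<in> carrier M) \<longrightarrow>
    S \<subseteq> carrier (span_module R M g n) \<longrightarrow> h \<in> tensor_relations R (span_module R M g n) N)"
  using assms unfolding tensor_relations_def
proof (elim UnE CollectE exE conjE, goal_cases)
  case (1 x y n)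
  then show ?case
    by (intro exI[of _ "{x, y}"]) (simp del: span_module_simps(4), blast)
next
  case (2 x n k)
  then show ?case
    by (intro exI[of _ "{x}"]) (simp del: span_module_simps(4), blast)
next
  case (3 r x n)
  then show ?case
    by (intro exI[of _ "{x}"]) (simp del: span_module_simps(4), blast)
qed

(* An element of the tensor kernel of M and N already lies in the tensor kernel of every
   submodule of M which contains a certain finite set. *)
lemma tensor_kernel_finite_support:
  assumes "z \<in> tensor_kernel R M N" and "module R M" and "module R N"
  shows "\<exists>S. finite S \<and> S \<subseteq> carrier M \<and> (\<forall>g n. (\<forall>i<n. g i \<in> carrier M) \<longrightarrow>
    S \<subseteq> carrier (span_module R M g n) \<longrightarrow> z \<in> tensor_kernel R (span_module R M g n) N)"
    (is "?P z")
  using assms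
proof (induction rule: tensor_kernel_induct)
  case zero
  then show ?case by (intro exI[of _ "{}"]) (simp add: tensor_kernel_zero)
next
  case (add h k)
  then obtain S T where
    "finite S" "S \<subseteq> carrier M" "\<forall>g n. (\<forall>i<n. g i \<in> carrier M) \<longrightarrow>
    S \<subseteq> carrier (span_module R M g n) \<longrightarrow> h \<in> tensor_kernel R (span_module R M g n) N"
    "finite T" "T \<subseteq> carrier M" "\<forall>g n. (\<forall>i<n. g i \<in> carrier M) \<longrightarrow>
    T \<subseteq> carrier (span_module R M g n) \<longrightarrow> k \<in> tensor_kernel R (span_module R M g n) N"
    by blast
  then show ?case
    by (intro exI[of _ "S \<union> T"]) (simp del: span_module_simps(4) add: tensor_kernel_add)
next
  case (rel h)
  then show ?case using tensor_relations_finite_support[OF rel] tensor_kernel_rel by meson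
next
  case (minus h)
  have M: "module R (span_module R M g n)" if "\<forall>i<n. g i \<in> carrier M" for g n
    using span_module_module assms that by blast
  show ?case using tensor_relations_finite_support[OF minus] tensor_kernel_rel
      tensor_kernel_minus[OF M \<open>module R N\<close>] by meson
qed

theorem pure_map_all_modules:
  fixes M :: "('a, 'm) module"
  assumes N: "module R N" and N': "module R N'" and f: "module_linear R N N' f"
    and pure: "pure_map R N N' f" and M: "module R M"
  shows "inj_on (tensor_map R M N' f) (carrier (tensor_product R M N))"
  unfolding inj_on_tensor_map_iff[OF M N N' f]
proof (intro ballI impI)
  fix z assume z: "z \<in> carrier (free_on_pairs M N)" and hz: "frag_map id f z \<in> tensor_kernel R M N'"
  interpret M: module R M by fact
  obtain S where S: "finite S" "S \<subseteq> carrier M" "\<And>g n. (\<forall>i<n. g i \<in> carrier M) \<Longrightarrow>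
    S \<subseteq> carrier (span_module R M g n) \<Longrightarrow> frag_map id f z \<in> tensor_kernel R (span_module R M g n) N'"
    using tensor_kernel_finite_support[OF hz M N'] by blast
  have "finite (S \<union> fst ` Poly_Mapping.keys z)" using S by simp
  then obtain n :: nat and g where g: "S \<union> fst ` Poly_Mapping.keys z = g ` {i. i < n}"
    using finite_imp_nat_seg_image_inj_on[of "S \<union> fst ` Poly_Mapping.keys z"] by auto
  have "S \<union> fst ` Poly_Mapping.keys z \<subseteq> carrier M" using S z by auto
  then have gM: "\<And>i. i < n \<Longrightarrow> g i \<in> carrier M" unfolding g by auto
  let ?M1 = "span_module R M g n"
  note sub = M.span_module_subset[where g = g and n = n, OF gM]
  note cl = M.span_module_closed[where g = g and n = n, OF gM]
  have M1: "module R ?M1" using span_module_module[where g = g and n = n, OF M gM] .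
  have "S \<union> fst ` Poly_Mapping.keys z \<subseteq> carrier ?M1"
    unfolding g using M.generator_in_span[where g = g and n = n, OF gM] by blast
  then have SM1: "S \<subseteq> carrier ?M1" and zM1: "z \<in> carrier (free_on_pairs ?M1 N)"
    using z by (auto simp del: span_module_simps(4))
  have hz1: "frag_map id f z \<in> tensor_kernel R ?M1 N'" using S(3) gM SM1 by blast
  define \<phi> where "\<phi> m = {c \<in> UNIV \<rightarrow> carrier R. lin_comb M g n c = m}" for m
  define \<psi> where "\<psi> u = lin_comb M g n (SOME c. c \<in> u)" for u
  have inv: "\<psi> (\<phi> m) = m" if "m \<in> carrier ?M1" for m
  proof -
    have "\<exists>c. c \<in> \<phi> m" using that unfolding \<phi>_def by auto
    then have "(SOME c. c \<in> \<phi> m) \<in> \<phi> m" by (rule someI_ex)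
    then show ?thesis unfolding \<psi>_def \<phi>_def by blast
  qed
  define M2 :: "('a, (nat \<Rightarrow> 'a) set) module" where
    "M2 = \<lparr>carrier = \<phi> ` carrier ?M1, monoid.mult = undefined, one = undefined, zero = \<phi> \<zero>\<^bsub>M\<^esub>,
    add = (\<lambda>u v. \<phi> (\<psi> u \<oplus>\<^bsub>M\<^esub> \<psi> v)), smult = (\<lambda>r u. \<phi> (r \<odot>\<^bsub>M\<^esub> \<psi> u))\<rparr>"
  have M2: "module R M2"
    unfolding M2_def using sub cl inv by (rule M.transported_module)
  have lin1: "module_linear R ?M1 M2 \<phi>" and lin2: "module_linear R M2 ?M1 \<psi>"
    using cl inv by (auto simp: module_linear_def M2_def simp del: span_module_simps(4))
  have incl: "module_linear R ?M1 M id"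
    using sub by (auto simp: module_linear_def simp del: span_module_simps(4))
  have "frag_map \<phi> id (frag_map id f z) \<in> tensor_kernel R M2 N'"
    using frag_map_kernel[OF M1 N' M2 N' lin1 module_linear_id hz1] .
  moreover have "frag_map \<phi> id (frag_map id f z) = frag_map id f (frag_map \<phi> id z)"
    by (simp add: frag_map_comp)
  moreover have "frag_map \<phi> id z \<in> carrier (free_on_pairs M2 N)"
    using frag_map_carrier[OF lin1 module_linear_id zM1] .
  ultimately have "frag_map \<phi> id z \<in> tensor_kernel R M2 N"
    using pure M2 inj_on_tensor_map_iff[OF M2 N N' f] unfolding pure_map_def by metis
  then have "frag_map \<psi> id (frag_map \<phi> id z) \<in> tensor_kernel R ?M1 N"
    using frag_map_kernel[OF M2 N M1 N lin2 module_linear_id] by blast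
  moreover have "frag_map \<psi> id (frag_map \<phi> id z) = z"
    unfolding frag_map_comp o_id using zM1 inv
    by (intro frag_map_ident) (auto simp del: span_module_simps(4))
  ultimately have "z \<in> tensor_kernel R ?M1 N" by simp
  then have "frag_map id id z \<in> tensor_kernel R M N"
    using frag_map_kernel[OF M1 N M N incl module_linear_id] by blast
  moreover have "frag_map id id z = z" by (rule frag_map_ident) simp
  ultimately show "z \<in> tensor_kernel R M N" by metis
qed

end

theory Submission
  imports Defs "HOL-Algebra.QuotRing"
begin

text \<open>Let \<open>I\<close> be generated by \<open>m = \<mu>(I)\<close> elements. A monomial of degree \<open>m q\<close> in these generators
  contains one of them with exponent at least \<open>q\<close>, so \<open>I\<close> to the power \<open>m q\<close> lies in the \<open>q\<close>-th
  Frobenius power of \<open>I\<close>. Hence \<open>\<nu>(q) \<le> N m q\<close>, which bounds all the ratios \<open>\<nu>(q)/q\<close>.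

  If \<open>R\<close> is \<open>F\<close>-pure, then \<open>f\<^sup>p\<close> lies in the \<open>p\<close>-th Frobenius power of an ideal \<open>J\<close> only if \<open>f\<close> lies
  in \<open>J\<close>. Applied to an element of \<open>\<aa>\<close> of index \<open>\<nu>(q)\<close> outside the \<open>q\<close>-th Frobenius power of \<open>I\<close>,
  this gives \<open>\<nu>(p q) \<ge> p \<nu>(q)\<close>: the ratios increase with \<open>e\<close> and converge to their supremum.\<close>

section \<open>Powers of ideals and Frobenius powers\<close>

text \<open>The colon ideal \<open>(K : a)\<close>: it turns "all products with \<open>a\<close> lie
  in \<open>K\<close>" into an inclusion of ideals, which need only be checked on
  generators.\<close>

lemma (in cring) colon_ideal:
  assumes "ideal K R" and "a \<in> carrier R"
  shows "ideal {x \<in> carrier R. x \<otimes> a \<in> K} R"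
proof -
  interpret K: ideal K R by fact
  show ?thesis
  proof (rule idealI)
    show "ring R" by (rule ring_axioms)
    show "subgroup {x \<in> carrier R. x \<otimes> a \<in> K} (add_monoid R)"
      using assms by unfold_locales (auto simp: l_distr l_minus simp flip: a_inv_def)
  next
    fix x r assume x: "x \<in> {x \<in> carrier R. x \<otimes> a \<in> K}" and r: "r \<in> carrier R"
    then have "r \<otimes> (x \<otimes> a) \<in> K" using K.I_l_closed by blast
    with x r assms show "r \<otimes> x \<in> {x \<in> carrier R. x \<otimes> a \<in> K}" "x \<otimes> r \<in> {x \<in> carrier R. x \<otimes> a \<in> K}"
      by (auto simp: m_ac)
  qed
qed

lemma (in cring) ideals_set_pow_0: "I [^]\<^bsub>ideals_set R\<^esub> (0::nat) = carrier R"
  by (simp add: nat_pow_def ideals_set_def)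

lemma (in cring) ideals_set_pow_Suc:
  "I [^]\<^bsub>ideals_set R\<^esub> Suc n = (I [^]\<^bsub>ideals_set R\<^esub> n) \<cdot> I"
  by (simp add: nat_pow_def ideals_set_def)

lemma (in cring) ideals_set_pow_ideal: "ideal I R \<Longrightarrow> ideal (I [^]\<^bsub>ideals_set R\<^esub> (n::nat)) R"
  by (induction n) (simp_all add: ideals_set_pow_0 ideals_set_pow_Suc oneideal ideal_prod_is_ideal
      del: Group.nat_pow_0 Group.nat_pow_Suc)

lemma ideal_prod_subsetI:
  assumes "ideal K R" and "\<And>x y. x \<in> I \<Longrightarrow> y \<in> J \<Longrightarrow> x \<otimes>\<^bsub>R\<^esub> y \<in> K"
  shows "I \<cdot>\<^bsub>R\<^esub> J \<subseteq> K"
proof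
  interpret ideal K R by fact
  fix z assume "z \<in> I \<cdot>\<^bsub>R\<^esub> J"
  then show "z \<in> K" by induction (use assms(2) in auto)
qed

text \<open>A monomial of degree \<open>s\<close> in the generators must contain some \<open>a\<close> with exponent at least
  \<open>e a\<close>. The pigeonhole argument becomes an induction on \<open>s\<close>: passing from \<open>K\<close> to the colon ideal of
  \<open>K\<close> by \<open>a\<close> lowers the exponent \<open>e a\<close> by one.\<close>

lemma (in cring) genideal_pow_subset:
  assumes A: "finite A" "A \<subseteq> carrier R"
    and "ideal K R" and "\<And>a. a \<in> A \<Longrightarrow> a [^] (e a :: nat) \<in> K" and "sum e A < s + card A"
  shows "(Idl A) [^]\<^bsub>ideals_set R\<^esub> s \<subseteq> K"
  using assms(3-)
proof (induction s arbitrary: K e)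
  case K: (0 K e)
  \<comment> \<open>If all exponents were at least 1, their sum would be at least
    \<open>card A\<close>. An exponent 0 puts \<open>\<one>\<close> into \<open>K\<close>.\<close>
  then have "\<exists>a \<in> A. e a = 0"
    using sum_mono[of A "\<lambda>_. 1" e] by (force simp: Suc_le_eq)
  then have "\<one> \<in> K" using K by force
  with K(1) have "K = carrier R" by (rule ideal.one_imp_carrier)
  then show ?case using ideals_set_pow_0[of "Idl A"] by simp
next
  case (Suc s K e)
  interpret K: ideal K R by fact
  have IA: "ideal (Idl A) R" using A(2) by (rule genideal_ideal)
  show ?case
  proof (cases "\<exists>a \<in> A. e a = 0")
    case True
    then have "\<one> \<in> K" using Suc.prems(2) by force
    then have "K = carrier R" by (rule K.one_imp_carrier)
    then show ?thesis
      using ideal.Icarr[OF ideals_set_pow_ideal[OF IA]] by blast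
  next
    case False
    \<comment> \<open>Lowering \<open>e a\<close> decreases the sum of the exponents by exactly one,
      matching the step from \<open>Suc s\<close> to \<open>s\<close>; as \<open>e a\<close> is
      positive, the subtraction does not truncate.\<close>
    have colon: "(Idl A) [^]\<^bsub>ideals_set R\<^esub> s \<subseteq> {x \<in> carrier R. x \<otimes> a \<in> K}" if a: "a \<in> A" for a
    proof (rule Suc.IH[where e = "e(a := e a - 1)"])
      show "ideal {x \<in> carrier R. x \<otimes> a \<in> K} R" using a A Suc.prems by (intro colon_ideal) auto
    next
      fix b assume b: "b \<in> A"
      then have car: "a \<in> carrier R" "b \<in> carrier R" using a A by auto
      show "b [^] (e(a := e a - 1)) b \<in> {x \<in> carrier R. x \<otimes> a \<in> K}"
      proof (cases "b = a")
        case True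
        have "a [^] (e a - 1) \<otimes> a = a [^] Suc (e a - 1)" by simp
        also have "Suc (e a - 1) = e a" using False a by simp
        finally show ?thesis using True car a Suc.prems(2) by simp
      next
        case False
        then show ?thesis using car b Suc.prems(2) by (simp add: K.I_r_closed)
      qed
    next
      have "sum e A = e a + sum e (A - {a})" using A a by (simp add: sum.remove)
      moreover have "sum (e(a := e a - 1)) A = e a - 1 + sum e (A - {a})"
        using A a by (simp add: sum.remove)
      ultimately show "sum (e(a := e a - 1)) A < s + card A"
        using Suc.prems(3) False a by (auto simp: gr0_conv_Suc)
    qed
    show ?thesis
      unfolding ideals_set_pow_Suc
    proof (rule ideal_prod_subsetI[OF Suc.prems(1)])
      fix x y assume x: "x \<in> (Idl A) [^]\<^bsub>ideals_set R\<^esub> s" and y: "y \<in> Idl A"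
      have xc: "x \<in> carrier R" using ideal.Icarr[OF ideals_set_pow_ideal[OF IA] x] .
      \<comment> \<open>With \<open>x\<close> fixed, the \<open>y\<close> multiplying
        \<open>x\<close> into \<open>K\<close> form an ideal, and \<open>colon\<close> puts every
        generator into it.\<close>
      have "Idl A \<subseteq> {y \<in> carrier R. y \<otimes> x \<in> K}"
      proof (rule genideal_minimal[OF colon_ideal[OF Suc.prems(1) xc]], intro subsetI CollectI conjI)
        fix a assume a: "a \<in> A"
        then show ac: "a \<in> carrier R" using A(2) by blast
        show "a \<otimes> x \<in> K" using colon[OF a] x m_comm[OF xc ac] by auto
      qed
      with y have "y \<in> carrier R" "y \<otimes> x \<in> K" by auto
      with xc show "x \<otimes> y \<in> K" by (simp add: m_comm)
    qed
  qed
qed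

section \<open>Frobenius powers and their comparison with ordinary powers\<close>

lemma (in cring) frobenius_power_ideal:
  assumes "ideal I R"
  shows "ideal (frobenius_power R q I) R"
  unfolding frobenius_power_def using ideal.Icarr[OF assms] by (intro genideal_ideal) auto

lemma (in cring) pow_in_frobenius_power:
  assumes "ideal I R" and "f \<in> I"
  shows "f [^] q \<in> frobenius_power R q I"
  unfolding frobenius_power_def using ideal.Icarr[OF assms(1)] assms(2)
  by (intro subsetD[OF genideal_self]) auto

lemma (in cring) frobenius_power_subset:
  assumes "ideal I R" and "q > 0"
  shows "frobenius_power R q I \<subseteq> I"
  unfolding frobenius_power_def
proof (rule genideal_minimal[OF assms(1)], safe)
  fix f assume f: "f \<in> I"
  obtain n where "q = Suc n" using assms(2) gr0_conv_Suc by auto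
  with f show "f [^] q \<in> I"
    using ideal.Icarr[OF assms(1) f] by (simp add: ideal.I_l_closed[OF assms(1)])
qed

text \<open>Each generator \<open>f^(q p)\<close> is the \<open>p\<close>-th power of
  \<open>f^q\<close>, an element of the inner Frobenius power. This lets one application of purity
  pass from exponent \<open>q\<close> to \<open>q p\<close>.\<close>

lemma (in cring) frobenius_power_mult_subset:
  assumes "ideal I R"
  shows "frobenius_power R (q * p) I \<subseteq> frobenius_power R p (frobenius_power R q I)"
  unfolding frobenius_power_def[of R "q * p" I]
proof (rule genideal_minimal, safe)
  show "ideal (frobenius_power R p (frobenius_power R q I)) R"
    by (intro frobenius_power_ideal assms)
next
  fix f assume f: "f \<in> I"
  have "(f [^] q) [^] p \<in> frobenius_power R p (frobenius_power R q I)"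
    by (intro pow_in_frobenius_power frobenius_power_ideal assms f)
  then show "f [^] (q * p) \<in> frobenius_power R p (frobenius_power R q I)"
    using ideal.Icarr[OF assms f] by (simp add: nat_pow_pow)
qed

lemma (in noetherian_ring) min_num_generatorsE:
  assumes "ideal I R"
  obtains A where "A \<subseteq> carrier R" "finite A" "card A = min_num_generators R I" "Idl A = I"
proof -
  have "\<exists>n. \<exists>A. A \<subseteq> carrier R \<and> finite A \<and> card A = n \<and> Idl A = I"
    using finetely_gen[OF assms] by metis
  from LeastI_ex[OF this] show ?thesis
    using that unfolding min_num_generators_def by blast
qed

lemma (in cring) pow_subset_frobenius_power:
  assumes "noetherian_ring R" and I: "ideal I R" and "I \<noteq> {\<zero>}"
  shows "I [^]\<^bsub>ideals_set R\<^esub> (min_num_generators R I * q) \<subseteq> frobenius_power R q I"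
proof -
  obtain A where A: "A \<subseteq> carrier R" "finite A" "card A = min_num_generators R I" "Idl A = I"
    using noetherian_ring.min_num_generatorsE[OF assms(1,2)] .
  \<comment> \<open>The empty set generates the zero ideal. Positivity of \<open>card A\<close>
    makes the strict inequality \<open>card A * q < card A * q + card A\<close> available.\<close>
  have "A \<noteq> {}"
    using genideal_minimal[OF zeroideal, of A] A(4) assms(3)
      additive_subgroup.zero_closed[OF ideal.axioms(1)[OF I]] by auto
  then have "card A > 0" using A(2) by (simp add: card_gt_0_iff)
  moreover have "A \<subseteq> I" using genideal_self[OF A(1)] A(4) by simp
  ultimately have "(Idl A) [^]\<^bsub>ideals_set R\<^esub> (card A * q) \<subseteq> frobenius_power R q I"
    using A(1,2) by (intro genideal_pow_subset[where e = "\<lambda>_. q"] frobenius_power_ideal I)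
      (auto intro!: pow_in_frobenius_power I)
  then show ?thesis using A by simp
qed


section \<open>The Frobenius endomorphism\<close>

lemma (in cring) binomial:
  assumes x: "x \<in> carrier R" and y: "y \<in> carrier R"
  shows "(x \<oplus> y) [^] (n::nat) = (\<Oplus>k \<in> {..n}. add_pow R (n choose k) (x [^] k \<otimes> y [^] (n - k)))"
proof (induction n)
  case 0
  then show ?case by simp
next
  case (Suc n)
  define S where "S = (\<Oplus>k \<in> {..n}. add_pow R (n choose k) (x [^] k \<otimes> y [^] (n - k)))"
  have Sc: "S \<in> carrier R" unfolding S_def using x y by (intro finsum_closed) auto
  have "x \<otimes> S = (\<Oplus>k \<in> {..n}. add_pow R (n choose k) (x [^] Suc k \<otimes> y [^] (n - k)))"
    unfolding S_def using x y
    by (subst finsum_rdistr) (auto intro!: finsum_cong' simp: add_pow_rdistr m_ac)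
  have "y \<otimes> S = (\<Oplus>k \<in> {..n}. add_pow R (n choose k) (x [^] k \<otimes> y [^] (Suc n - k)))"
    unfolding S_def using x y
    by (subst finsum_rdistr) (auto intro!: finsum_cong' simp: add_pow_rdistr m_ac Suc_diff_le)
  \<comment> \<open>The new top term has coefficient \<open>n choose Suc n\<close>, which is 0.
    Splitting off the term at 0 and shifting then aligns this sum with \<open>x \<otimes> S\<close>,
    so that Pascal's rule applies termwise.\<close>
  also have "\<dots> = (\<Oplus>k \<in> {..Suc n}. add_pow R (n choose k) (x [^] k \<otimes> y [^] (Suc n - k)))"
    using x y by (subst finsum_Suc) (auto intro!: finsum_closed simp: binomial_eq_0)
  also have "\<dots> = (\<Oplus>k \<in> {..n}. add_pow R (n choose Suc k) (x [^] Suc k \<otimes> y [^] (n - k))) \<oplus> y [^] Suc n"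
    using x y by (subst finsum_Suc2) (auto intro!: finsum_closed)
  finally have yS: "y \<otimes> S = \<dots>" .
  have "(x \<oplus> y) [^] Suc n = x \<otimes> S \<oplus> y \<otimes> S"
    using x y Sc Suc by (simp add: S_def[symmetric] m_comm r_distr)
  also have "\<dots> = (\<Oplus>k \<in> {..n}. add_pow R (n choose k) (x [^] Suc k \<otimes> y [^] (n - k)) \<oplus>
      add_pow R (n choose Suc k) (x [^] Suc k \<otimes> y [^] (n - k))) \<oplus> y [^] Suc n"
    unfolding yS \<open>x \<otimes> S = _\<close> using x y by (subst finsum_addf) (auto simp: a_assoc intro!: finsum_closed)
  also have "(\<Oplus>k \<in> {..n}. add_pow R (n choose k) (x [^] Suc k \<otimes> y [^] (n - k)) \<oplus>
      add_pow R (n choose Suc k) (x [^] Suc k \<otimes> y [^] (n - k))) =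
    (\<Oplus>k \<in> {..n}. add_pow R (Suc n choose Suc k) (x [^] Suc k \<otimes> y [^] (Suc n - Suc k)))"
    using x y by (intro finsum_cong') (auto simp: add.nat_pow_mult)
  also have "\<dots> \<oplus> y [^] Suc n = (\<Oplus>k \<in> {..Suc n}. add_pow R (Suc n choose k) (x [^] k \<otimes> y [^] (Suc n - k)))"
    using x y by (subst finsum_Suc2) (auto intro!: finsum_closed)
  finally show ?case .
qed

text \<open>The multiple \<open>n x\<close> equals \<open>(n 1) x\<close>, and \<open>n 1\<close>
  vanishes because the additive order of \<open>\<one>\<close> divides \<open>n\<close>.\<close>

lemma (in ring) add_pow_characteristic_dvd:
  assumes "x \<in> carrier R" and "ring_characteristic R dvd n"
  shows "add_pow R n x = \<zero>"
proof -
  have "add_pow R n \<one> = \<zero>"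
    using assms(2) add.pow_eq_id[of \<one> n] by (simp add: ring_characteristic_def)
  then show ?thesis using add_pow_ldistr[of \<one> x n] assms(1) by simp
qed

lemma (in cring) freshmans_dream:
  assumes x: "x \<in> carrier R" and y: "y \<in> carrier R"
    and p: "Factorial_Ring.prime p" and char: "ring_characteristic R = p"
  shows "(x \<oplus> y) [^] p = x [^] p \<oplus> y [^] p"
proof -
  \<comment> \<open>The indices strictly between 0 and \<open>p\<close> become \<open>Suc k\<close>
    with \<open>k \<le> q\<close>; \<open>p\<close> divides their binomial coefficients.\<close>
  obtain q where q: "p = Suc (Suc q)"
    using prime_ge_2_nat[OF p] by (metis Suc_le_D numeral_2_eq_2 Suc_le_mono)
  define t where "t k = add_pow R (p choose k) (x [^] k \<otimes> y [^] (p - k))" for k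
  have tc: "t k \<in> carrier R" for k using x y by (simp add: t_def)
  have t0: "t (Suc k) = \<zero>" if "k \<le> q" for k
    unfolding t_def using x y p that
    by (intro add_pow_characteristic_dvd) (auto simp: char q simp del: binomial_Suc_Suc intro!: dvd_choose_prime)
  have "(x \<oplus> y) [^] p = (\<Oplus>k \<in> {..p}. t k)"
    unfolding t_def by (rule binomial[OF x y])
  also have "\<dots> = t p \<oplus> ((\<Oplus>k \<in> {..q}. t (Suc k)) \<oplus> t 0)"
    using finsum_Suc[of t "Suc q"] finsum_Suc2[of t q] tc by (simp add: q)
  also have "(\<Oplus>k \<in> {..q}. t (Suc k)) = \<zero>"
    using t0 by (intro add.finprod_one_eqI) auto
  finally show ?thesis using x y tc by (simp add: t_def)
qed

lemma (in cring) frobenius_ring_hom: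
  assumes "Factorial_Ring.prime p" and "ring_characteristic R = p"
  shows "(\<lambda>r. r [^] p) \<in> ring_hom R R"
  using assms by (intro ring_hom_memI) (auto simp: nat_pow_distrib freshmans_dream)


section \<open>Purity of the Frobenius map\<close>

text \<open>A common form for the three modules needed: \<open>h\<close> is the identity for R
  itself, the Frobenius map for \<open>frobenius_module\<close>, and the projection for a quotient
  ring.\<close>

definition scalar_restriction :: "('c, 'd) ring_scheme \<Rightarrow> ('a \<Rightarrow> 'c) \<Rightarrow> ('a, 'c) module" where
  "scalar_restriction S h = \<lparr>carrier = carrier S, monoid.mult = monoid.mult S, one = \<one>\<^bsub>S\<^esub>,
     zero = \<zero>\<^bsub>S\<^esub>, add = add S, smult = (\<lambda>r x. h r \<otimes>\<^bsub>S\<^esub> x)\<rparr>"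

lemma scalar_restriction_module:
  assumes "cring R" and "cring S" and h: "h \<in> ring_hom R S"
  shows "module R (scalar_restriction S h)"
proof -
  interpret R: cring R by fact
  interpret S: cring S by fact
  have "\<exists>y \<in> carrier S. y \<oplus>\<^bsub>S\<^esub> x = \<zero>\<^bsub>S\<^esub>" if "x \<in> carrier S" for x
    using that S.l_neg by blast
  then show ?thesis
    by (intro moduleI) (use R.cring_axioms in
      \<open>auto intro!: abelian_groupI simp: scalar_restriction_def ring_hom_closed[OF h] ring_hom_mult[OF h]
        ring_hom_add[OF h] ring_hom_one[OF h] S.a_ac S.m_assoc S.l_distr S.r_distr\<close>)
qed

lemma regular_module_eq: "regular_module R = scalar_restriction R (\<lambda>r. r)"
  by (simp add: regular_module_def scalar_restriction_def)

lemma frobenius_module_eq: "frobenius_module R p = scalar_restriction R (\<lambda>r. r [^]\<^bsub>R\<^esub> p)"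
  by (simp add: frobenius_module_def scalar_restriction_def)

text \<open>The evaluation map \<open>x \<otimes> f \<mapsto> f x\<close> from the tensor product of \<open>M\<close> and \<open>R\<close> to \<open>M\<close> is
  well defined.\<close>

lemma tensor_kernel_regular_module:
  assumes M: "module R M" and x: "x \<in> carrier M" and f: "f \<in> carrier R"
    and z: "frag_of (x, f) \<in> tensor_kernel R M (regular_module R)"
  shows "f \<odot>\<^bsub>M\<^esub> x = \<zero>\<^bsub>M\<^esub>"
proof -
  interpret module R M by fact
  let ?N = "regular_module R" and ?G = "add_monoid M"
  let ?F = "free_Abelian_group (carrier M \<times> carrier R)"
  have N: "module R ?N"
    unfolding regular_module_eq by (intro scalar_restriction_module ring_hom_memI is_cring) auto
  have N_simps [simp]: "carrier ?N = carrier R" "add ?N = add R" "smult ?N = monoid.mult R"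
    by (simp_all add: regular_module_def)
  \<comment> \<open>The evaluation is first defined on the free abelian group by its universal
    property; it factors through the tensor product once it kills the three kinds of
    relations.\<close>
  obtain \<phi> where \<phi>: "\<phi> \<in> hom ?F ?G"
    and \<phi>_of: "\<And>u. u \<in> carrier M \<times> carrier R \<Longrightarrow> \<phi> (frag_of u) = snd u \<odot>\<^bsub>M\<^esub> fst u"
  proof (rule comm_group.free_Abelian_group_universal[OF M.a_comm_group,
        of "\<lambda>u. snd u \<odot>\<^bsub>M\<^esub> fst u" "carrier M \<times> carrier R"])
  qed auto
  interpret \<phi>: group_hom ?F ?G \<phi>
    using \<phi> by (simp add: group_hom_def group_hom_axioms_def)
  have diff: "a - b \<in> carrier ?F \<and> \<phi> (a - b) = \<phi> a \<ominus>\<^bsub>M\<^esub> \<phi> b"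
    if "a \<in> carrier ?F" "b \<in> carrier ?F" for a b
  proof -
    have "- b \<in> carrier ?F" "\<phi> (- b) = \<ominus>\<^bsub>M\<^esub> \<phi> b"
      using \<phi>.hom_inv[OF that(2)] \<phi>.inv_closed[OF that(2)] that by (simp_all add: a_inv_def)
    then show ?thesis
      using that(1) \<phi>.hom_mult[of a "- b"] \<phi>.m_closed[of a "- b"] by (simp add: a_minus_def)
  qed
  have of_carrier: "frag_of u \<in> carrier ?F" if "u \<in> carrier M \<times> carrier R" for u
    using that by simp
  have cancel: "u \<oplus>\<^bsub>M\<^esub> v \<ominus>\<^bsub>M\<^esub> u \<ominus>\<^bsub>M\<^esub> v = \<zero>\<^bsub>M\<^esub>" if "u \<in> carrier M" "v \<in> carrier M" for u v
    using M.r_neg[of "u \<oplus>\<^bsub>M\<^esub> v"] that by (simp add: a_minus_def M.minus_add M.a_assoc)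
  have rel: "\<phi> h = \<zero>\<^bsub>M\<^esub>" if "h \<in> tensor_relations R M ?N" for h
    using that unfolding tensor_relations_def
  proof (elim UnE CollectE exE conjE, goal_cases)
    case (1 x y n)
    have "x \<oplus>\<^bsub>M\<^esub> y \<in> carrier M" using 1 by simp
    with 1 have "\<phi> h = n \<odot>\<^bsub>M\<^esub> (x \<oplus>\<^bsub>M\<^esub> y) \<ominus>\<^bsub>M\<^esub> n \<odot>\<^bsub>M\<^esub> x \<ominus>\<^bsub>M\<^esub> n \<odot>\<^bsub>M\<^esub> y"
      by (simp add: diff \<phi>_of of_carrier del: carrier_free_Abelian_group_iff)
    then show ?case using 1 by (simp add: smult_r_distr cancel)
  next
    case (2 x n k)
    then have "\<phi> h = (n \<oplus>\<^bsub>R\<^esub> k) \<odot>\<^bsub>M\<^esub> x \<ominus>\<^bsub>M\<^esub> n \<odot>\<^bsub>M\<^esub> x \<ominus>\<^bsub>M\<^esub> k \<odot>\<^bsub>M\<^esub> x"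
      by (simp add: diff \<phi>_of of_carrier del: carrier_free_Abelian_group_iff)
    then show ?case using 2 by (simp add: smult_l_distr cancel)
  next
    case (3 r x n)
    then have "\<phi> h = n \<odot>\<^bsub>M\<^esub> (r \<odot>\<^bsub>M\<^esub> x) \<ominus>\<^bsub>M\<^esub> (r \<otimes>\<^bsub>R\<^esub> n) \<odot>\<^bsub>M\<^esub> x"
      by (simp add: diff \<phi>_of of_carrier del: carrier_free_Abelian_group_iff)
    then show ?case using 3 by (simp add: smult_assoc1[symmetric] R.m_comm a_minus_def M.r_neg)
  qed
  have "tensor_relations R M ?N \<subseteq> carrier ?F"
    using tensor_relations_sub[OF M N] by simp
  with rel have "tensor_relations R M ?N \<subseteq> kernel ?F ?G \<phi>"
    unfolding kernel_def by fastforce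
  from \<phi>.generate_subgroup_incl[OF this \<phi>.subgroup_kernel]
  have "frag_of (x, f) \<in> kernel ?F ?G \<phi>"
    using z unfolding tensor_kernel_def N_simps by blast
  then show ?thesis using \<phi>_of x f by (simp add: kernel_def)
qed

text \<open>The annihilator in \<open>S\<close> of the tensor of \<open>x\<close> and 1. Sums are
  handled by the relations in the second slot; multiplication by an element of \<open>S\<close> is
  \<open>R\<close>-linear and so preserves the tensor kernel. Vanishing on a Frobenius power can
  thus be tested on generators.\<close>

lemma tensor_annihilator_ideal:
  fixes h :: "'a \<Rightarrow> 'c"
  assumes M: "module R M" and S: "cring S" and h: "h \<in> ring_hom R S" and x: "x \<in> carrier M"
  shows "ideal {c \<in> carrier S. frag_of (x, c) \<in> tensor_kernel R M (scalar_restriction S h)} S"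
    (is "ideal ?A S")
proof -
  interpret M: module R M by fact
  interpret S: cring S by fact
  let ?N = "scalar_restriction S h"
  let ?K = "tensor_kernel R M ?N"
  have N: "module R ?N" by (intro scalar_restriction_module M.is_cring S h)
  have N_simps [simp]: "carrier ?N = carrier S" "add ?N = add S"
    "smult ?N = (\<lambda>r x. h r \<otimes>\<^bsub>S\<^esub> x)"
    by (simp_all add: scalar_restriction_def)
  note minus = tensor_kernel_minus[OF M N]
  have add_rel: "frag_of (x, c \<oplus>\<^bsub>S\<^esub> d) - frag_of (x, c) - frag_of (x, d) \<in> ?K"
    if "c \<in> carrier S" "d \<in> carrier S" for c d
    using tensor_kernel_rel[OF tensor_relationsI(2)[OF x, of c ?N d]] that by simp
  \<comment> \<open>For \<open>c = d = 0\<close> the additivity relation collapses to minus the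
    generator at \<open>(x, 0)\<close>.\<close>
  have zero: "\<zero>\<^bsub>S\<^esub> \<in> ?A"
    using minus[OF add_rel[of "\<zero>\<^bsub>S\<^esub>" "\<zero>\<^bsub>S\<^esub>"]] by simp
  have add: "c \<oplus>\<^bsub>S\<^esub> d \<in> ?A" if "c \<in> ?A" "d \<in> ?A" for c d
    using tensor_kernel_add[OF tensor_kernel_add[OF add_rel[of c d]], of "frag_of (x, c)" "frag_of (x, d)"] that
    by simp
  have mult: "r \<otimes>\<^bsub>S\<^esub> c \<in> ?A" if "c \<in> ?A" and r: "r \<in> carrier S" for c r
  proof -
    have "module_linear R ?N ?N (\<lambda>c. r \<otimes>\<^bsub>S\<^esub> c)"
      using r ring_hom_closed[OF h] by (simp add: module_linear_def S.r_distr S.m_lcomm)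
    from frag_map_kernel[OF M N M N module_linear_id this, of "frag_of (x, c)"]
    show ?thesis using that by simp
  qed
  have "\<ominus>\<^bsub>S\<^esub> c \<in> ?A" if "c \<in> ?A" for c
    using mult[of c "\<ominus>\<^bsub>S\<^esub> \<one>\<^bsub>S\<^esub>"] that by (simp add: S.l_minus)
  then have "subgroup ?A (add_monoid S)"
    using zero add by unfold_locales (auto simp flip: a_inv_def)
  then show ?thesis
    using mult S.ring_axioms by (intro idealI) (simp_all add: S.m_comm)
qed

text \<open>Test purity on the module \<open>R/J\<close>: if \<open>f\<^sup>p\<close> is a combination of \<open>p\<close>-th powers of elements of \<open>J\<close>,
  then the image of the tensor of \<open>1\<close> and \<open>f\<close> vanishes, so \<open>f\<close> is zero in \<open>R/J\<close>.\<close>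

lemma F_pure_imp_mem:
  assumes R: "cring R" and p: "Factorial_Ring.prime p" and char: "ring_characteristic R = p"
    and pure: "F_pure R p" and J: "ideal J R" and f: "f \<in> carrier R"
    and fp: "f [^]\<^bsub>R\<^esub> p \<in> frobenius_power R p J"
  shows "f \<in> J"
proof -
  interpret cring R by fact
  interpret J: ideal J R by fact
  interpret Q: cring "R Quot J" by (rule J.quotient_is_cring[OF R])
  note F = frobenius_ring_hom[OF p char] and \<pi> = J.rcos_ring_hom
  let ?M = "scalar_restriction (R Quot J) ((+>\<^bsub>R\<^esub>) J)"
  let ?N = "regular_module R" and ?N' = "frobenius_module R p" and ?x = "\<one>\<^bsub>R Quot J\<^esub>"
  have M_simps: "carrier ?M = carrier (R Quot J)" "zero ?M = \<zero>\<^bsub>R Quot J\<^esub>" "add ?M = add (R Quot J)"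
    "smult ?M = (\<lambda>r x. (J +>\<^bsub>R\<^esub> r) \<otimes>\<^bsub>R Quot J\<^esub> x)"
    by (simp_all add: scalar_restriction_def)
  have M: "module R ?M" by (intro scalar_restriction_module R Q.is_cring \<pi>)
  have N: "module R ?N" unfolding regular_module_eq
    by (intro scalar_restriction_module R ring_hom_memI) auto
  have N': "module R ?N'" unfolding frobenius_module_eq
    by (intro scalar_restriction_module R F)
  have lin: "module_linear R ?N ?N' (\<lambda>r. r [^]\<^bsub>R\<^esub> p)"
    using ring_hom_closed[OF F] ring_hom_add[OF F] ring_hom_mult[OF F]
    by (simp add: module_linear_def regular_module_def frobenius_module_def)
  have smult_x: "r \<odot>\<^bsub>?M\<^esub> ?x = J +>\<^bsub>R\<^esub> r" if "r \<in> carrier R" for r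
    using ring_hom_closed[OF \<pi> that] by (simp add: M_simps)
  have zero_iff: "J +>\<^bsub>R\<^esub> r = \<zero>\<^bsub>R Quot J\<^esub> \<longleftrightarrow> r \<in> J" if "r \<in> carrier R" for r
    using that a_rcos_zero[OF J] a_coset_join1[OF _ that] J.a_subgroup by (auto simp: FactRing_def)
  have "frobenius_power R p J \<subseteq> {c \<in> carrier R. frag_of (?x, c) \<in> tensor_kernel R ?M ?N'}"
    unfolding frobenius_power_def
  proof (rule genideal_minimal, unfold frobenius_module_eq)
    show "ideal {c \<in> carrier R. frag_of (?x, c) \<in>
        tensor_kernel R ?M (scalar_restriction R (\<lambda>r. r [^]\<^bsub>R\<^esub> p))} R"
      by (intro tensor_annihilator_ideal M R F) (simp add: M_simps)
  next
    show "{j [^]\<^bsub>R\<^esub> p |j. j \<in> J} \<subseteq> {c \<in> carrier R. frag_of (?x, c) \<in>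
        tensor_kernel R ?M (scalar_restriction R (\<lambda>r. r [^]\<^bsub>R\<^esub> p))}"
    proof (clarify, fold frobenius_module_eq, intro conjI)
      fix j assume j: "j \<in> J"
      note jc = J.Icarr[OF j]
      then show "j [^]\<^bsub>R\<^esub> p \<in> carrier R" by simp
      have N'_simps: "carrier ?N' = carrier R" "smult ?N' = (\<lambda>r x. (r [^]\<^bsub>R\<^esub> p) \<otimes>\<^bsub>R\<^esub> x)"
        by (simp_all add: frobenius_module_def)
      have zero_rel: "- frag_of (zero ?M, \<one>\<^bsub>R\<^esub>) \<in> tensor_kernel R ?M ?N'"
        using tensor_kernel_rel[OF tensor_relationsI(1)[of "zero ?M" ?M "zero ?M" "\<one>\<^bsub>R\<^esub>" ?N' R]]
        by (simp add: M_simps N'_simps)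
      \<comment> \<open>Moving the scalar \<open>j\<close> across the tensor turns it into
        \<open>j^p\<close> on the Frobenius side, while \<open>j\<close> kills \<open>?x\<close>
        because its class in \<open>R/J\<close> is zero.\<close>
      have "frag_of (zero ?M, \<one>\<^bsub>R\<^esub>) - frag_of (?x, j [^]\<^bsub>R\<^esub> p) \<in> tensor_kernel R ?M ?N'"
        using tensor_kernel_rel[OF tensor_relationsI(3)[of j R ?x ?M "\<one>\<^bsub>R\<^esub>" ?N']] jc j zero_iff[OF jc]
        by (simp add: smult_x N'_simps) (simp add: M_simps)
      from tensor_kernel_minus[OF M N' tensor_kernel_add[OF zero_rel this]]
      show "frag_of (?x, j [^]\<^bsub>R\<^esub> p) \<in> tensor_kernel R ?M ?N'" by simp
    qed
  qed
  with fp have "frag_map id (\<lambda>r. r [^]\<^bsub>R\<^esub> p) (frag_of (?x, f)) \<in> tensor_kernel R ?M ?N'"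
    by auto
  moreover have "frag_of (?x, f) \<in> carrier (free_on_pairs ?M ?N)"
    using f by (simp add: M_simps regular_module_def)
  \<comment> \<open>The elements of \<open>R/J\<close> are cosets, not the sets of coefficient
    sequences over which \<open>pure_map\<close> quantifies, so purity is transferred by
    \<open>pure_map_all_modules\<close>.\<close>
  ultimately have "frag_of (?x, f) \<in> tensor_kernel R ?M ?N"
    using pure_map_all_modules[OF N N' lin pure[unfolded F_pure_def] M]
    unfolding inj_on_tensor_map_iff[OF M N N' lin] by blast
  then have "f \<odot>\<^bsub>?M\<^esub> ?x = zero ?M"
    by (rule tensor_kernel_regular_module[OF M _ f, rotated]) (simp add: M_simps)
  then show ?thesis using f zero_iff smult_x by (simp add: M_simps(2))
qed


section \<open>Thresholds of filtrations\<close>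

lemma ideal_filtration_antimono:
  assumes "ideal_filtration R \<aa>" and "m \<le> n"
  shows "\<aa> n \<subseteq> \<aa> m"
  using assms lift_Suc_antimono_le[of \<aa>] by (auto simp: ideal_filtration_def)

lemma (in cring) ideal_filtration_pow:
  assumes \<aa>: "ideal_filtration R \<aa>" and f: "f \<in> \<aa> r"
  shows "f [^] k \<in> \<aa> (r * k)"
proof (induction k)
  case 0
  then show ?case using \<aa> by (simp add: ideal_filtration_def)
next
  case (Suc k)
  have "\<aa> (r * k) \<cdot> \<aa> r \<subseteq> \<aa> (r * k + r)"
    using \<aa> by (simp add: ideal_filtration_def)
  with ideal_prod.prod[OF Suc f, of R] show ?case by (auto simp: add.commute)
qed

text \<open>Replaces the supremum in \<open>enat\<close> by an attained natural number. The index
  set is bounded by the inclusion of \<open>I^(m q)\<close> in the Frobenius power, and contains 0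
  because \<open>I\<close> is proper.\<close>

lemma (in cring) nu_eq_enat:
  assumes "noetherian_ring R" and I: "ideal I R" and "I \<noteq> {\<zero>}" and "I \<noteq> carrier R"
    and \<aa>: "ideal_filtration R \<aa>" and N: "\<And>s. \<aa> (N * s) \<subseteq> I [^]\<^bsub>ideals_set R\<^esub> s" and "q > 0"
  obtains k where "nu R I \<aa> q = enat k" "\<not> \<aa> k \<subseteq> frobenius_power R q I"
    "k \<le> N * min_num_generators R I * q"
proof -
  define A where "A = {r. \<not> \<aa> r \<subseteq> frobenius_power R q I}"
  define b where "b = N * min_num_generators R I * q"
  have "\<aa> b \<subseteq> frobenius_power R q I"
    using N[of "min_num_generators R I * q"] pow_subset_frobenius_power[OF assms(1-3), of q]
    by (auto simp: b_def mult.assoc)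
  \<comment> \<open>An index beyond \<open>b\<close> would give an ideal inside
    \<open>\<aa> b\<close>, hence inside the Frobenius power.\<close>
  then have le: "r \<le> b" if "r \<in> A" for r
    using that ideal_filtration_antimono[OF \<aa>, of b r] by (force simp: A_def)
  then have fin: "finite A" by (meson finite_nat_set_iff_bounded_le)
  have "\<aa> 0 = carrier R" using \<aa> by (simp add: ideal_filtration_def)
  moreover have "\<not> carrier R \<subseteq> I"
    using assms(4) ideal.Icarr[OF I] by blast
  ultimately have "0 \<in> A"
    using frobenius_power_subset[OF I \<open>q > 0\<close>] by (auto simp: A_def)
  with fin have Max: "Max A \<in> A" by (intro Max_in) auto
  have "nu R I \<aa> q = enat (Max A)"
    unfolding nu_def A_def[symmetric]
    by (intro antisym SUP_least SUP_upper) (use Max fin in auto)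
  with Max le that show ?thesis unfolding A_def b_def by blast
qed

text \<open>Purity is used in contrapositive form, with \<open>J\<close> the \<open>q\<close>-th
  Frobenius power: the \<open>p\<close>-th power of a witness at \<open>k\<close> is a witness at
  \<open>k * p\<close>.\<close>

lemma (in cring) nu_mult_le:
  assumes p: "Factorial_Ring.prime p" and char: "ring_characteristic R = p" and pure: "F_pure R p"
    and I: "ideal I R" and \<aa>: "ideal_filtration R \<aa>" and k: "\<not> \<aa> k \<subseteq> frobenius_power R q I"
  shows "enat (k * p) \<le> nu R I \<aa> (q * p)"
proof -
  from k obtain f where f: "f \<in> \<aa> k" "f \<notin> frobenius_power R q I" by blast
  have "ideal (\<aa> k) R" using \<aa> by (simp add: ideal_filtration_def)
  from ideal.Icarr[OF this f(1)] have "f \<in> carrier R" .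
  with f(2) have "f [^] p \<notin> frobenius_power R p (frobenius_power R q I)"
    using F_pure_imp_mem[OF is_cring p char pure frobenius_power_ideal[OF I]] by blast
  then have "\<not> \<aa> (k * p) \<subseteq> frobenius_power R (q * p) I"
    using ideal_filtration_pow[OF \<aa> f(1), of p] frobenius_power_mult_subset[OF I, of q p] by blast
  then show ?thesis unfolding nu_def by (intro SUP_upper) simp
qed

theorem theorem3p13:
  fixes R :: "('a, 'b) ring_scheme" and I :: "'a set" and \<aa> :: "nat \<Rightarrow> 'a set" and p N :: nat
  assumes "cring R" and "noetherian_ring R"
    and "Factorial_Ring.prime p" and "ring_characteristic R = p"
    and "ideal I R" and "I \<noteq> {\<zero>\<^bsub>R\<^esub>}" and "I \<noteq> carrier R"
    and "ideal_filtration R \<aa>"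
    and "\<And>s. \<aa> (N * s) \<subseteq> I [^]\<^bsub>ideals_set R\<^esub> s"
  shows "0 \<le> lower_F_threshold R p I \<aa> \<and>
      lower_F_threshold R p I \<aa> \<le> ereal (real (N * min_num_generators R I)) \<and>
      0 \<le> upper_F_threshold R p I \<aa> \<and>
      upper_F_threshold R p I \<aa> \<le> ereal (real (N * min_num_generators R I)) \<and>
      (F_pure R p \<longrightarrow>
        F_threshold_exists R p I \<aa> \<and>
        0 \<le> F_threshold R p I \<aa> \<and>
        ereal (F_threshold R p I \<aa>) = (SUP e. nu_ratio R p I \<aa> e) \<and>
        F_threshold R p I \<aa> \<le> real (N * min_num_generators R I))"
proof -
  interpret cring R by fact
  define B where "B = N * min_num_generators R I"
  have p0: "p > 0" using assms(3) by (rule prime_gt_0_nat)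
  have "\<exists>k. \<forall>e. nu R I \<aa> (p ^ e) = enat (k e) \<and> \<not> \<aa> (k e) \<subseteq> frobenius_power R (p ^ e) I \<and>
      k e \<le> B * p ^ e"
    using nu_eq_enat[OF assms(2,5-9)] p0 unfolding B_def by (intro choice) (metis zero_less_power)
  then obtain k where nu: "\<And>e. nu R I \<aa> (p ^ e) = enat (k e)"
    and k: "\<And>e. \<not> \<aa> (k e) \<subseteq> frobenius_power R (p ^ e) I" and le: "\<And>e. k e \<le> B * p ^ e"
    by blast
  have ratio: "nu_ratio R p I \<aa> e = ereal (real (k e) / real (p ^ e))" for e
    using p0 by (simp add: nu_ratio_def nu)
  have nonneg: "0 \<le> nu_ratio R p I \<aa> e" for e
    unfolding ratio by simp
  have bound: "nu_ratio R p I \<aa> e \<le> ereal (real B)" for e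
  proof -
    have "real (k e) \<le> real B * real (p ^ e)" using le[of e] by (metis of_nat_le_iff of_nat_mult)
    then show ?thesis unfolding ratio using p0 by (simp add: divide_le_eq)
  qed
  have lower: "0 \<le> lower_F_threshold R p I \<aa>"
    unfolding lower_F_threshold_def by (intro Liminf_bounded always_eventually allI nonneg)
  have upper: "upper_F_threshold R p I \<aa> \<le> ereal (real B)"
    unfolding upper_F_threshold_def by (intro Limsup_bounded always_eventually allI bound)
  \<comment> \<open>This supplies the two missing bounds: the upper one for the liminf and the lower
    one for the limsup.\<close>
  have lower_upper: "lower_F_threshold R p I \<aa> \<le> upper_F_threshold R p I \<aa>"
    unfolding lower_F_threshold_def upper_F_threshold_def by (intro Liminf_le_Limsup) simp
  have exists: "F_threshold_exists R p I \<aa> \<and> 0 \<le> F_threshold R p I \<aa> \<and>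
      ereal (F_threshold R p I \<aa>) = (SUP e. nu_ratio R p I \<aa> e) \<and> F_threshold R p I \<aa> \<le> real B"
    if pure: "F_pure R p"
  proof -
    have "incseq (nu_ratio R p I \<aa>)"
    proof (rule incseq_SucI)
      fix e
      have "enat (k e * p) \<le> nu R I \<aa> (p ^ e * p)"
        by (rule nu_mult_le[OF assms(3,4) pure assms(5,8) k])
      \<comment> \<open>Division by \<open>p ^ Suc e\<close> makes this the monotonicity of the
        ratios.\<close>
      then have "k e * p \<le> k (Suc e)" using nu[of "Suc e"] by (simp add: mult.commute)
      then have "real (k e) * real p \<le> real (k (Suc e))" by (metis of_nat_le_iff of_nat_mult)
      then show "nu_ratio R p I \<aa> e \<le> nu_ratio R p I \<aa> (Suc e)"
        unfolding ratio using p0 by (simp add: field_simps)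
    qed
    then have lim: "nu_ratio R p I \<aa> \<longlonglongrightarrow> (SUP e. nu_ratio R p I \<aa> e)" by (rule LIMSEQ_SUP)
    have eqs: "lower_F_threshold R p I \<aa> = (SUP e. nu_ratio R p I \<aa> e)"
      "upper_F_threshold R p I \<aa> = (SUP e. nu_ratio R p I \<aa> e)"
      unfolding lower_F_threshold_def upper_F_threshold_def
      using lim by (simp_all add: lim_imp_Liminf lim_imp_Limsup)
    \<comment> \<open>Lying between 0 and \<open>B\<close>, the supremum is finite, so the passage
      to a real number loses nothing.\<close>
    obtain c where c: "(SUP e. nu_ratio R p I \<aa> e) = ereal c" "0 \<le> c" "c \<le> real B"
      using lower upper unfolding eqs by (cases "SUP e. nu_ratio R p I \<aa> e") auto
    then show ?thesis by (simp add: F_threshold_exists_def F_threshold_def eqs)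
  qed
  show ?thesis
    using lower upper lower_upper exists unfolding B_def by (meson order_trans)
qed

end
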